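(* Let $m, n$ be positive integers. If $B \in \{+1,-1\}^{m\times n}$ is chosen uniformly at random among all $m\times n$ matrices with entries in $\{+1,-1\}$, then $$E(\det(BB^T)) = m!\binom{n}{m}.$$
   Context: $E$ denotes expectation with respect to the uniform distribution on the $2^{mn}$ matrices in $\{+1,-1\}^{m\times n}$. *)

theory Defs
  imports
    "HOL-Probability.Probability_Mass_Function"
    "Jordan_Normal_Form.Determinant"
begin

definition sign_mats :: "nat \<Rightarrow> nat \<Rightarrow> real mat set" where
  "sign_mats m n = {B \<in> carrier_mat m n. \<forall>i<m. \<forall>j<n. B $$ (i, j) \<in> {1, -1}}"

text \<open>
  The following facts show that \<open>sign_mats m n\<close> is a finite nonempty set with
  \<open>2 ^ (m * n)\<close> elements, so that \<open>pmf_of_set (sign_mats m n)\<close> really is the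
  uniform distribution (it is unspecified for infinite or empty sets).
\<close>

lemma bij_betw_sign_mats:
  "bij_betw (mat m n) (({0..<m} \<times> {0..<n}) \<rightarrow>\<^sub>E {1, -1}) (sign_mats m n)"
proof (rule bij_betw_byWitness
    [where f' = "\<lambda>B. restrict (\<lambda>ij. B $$ ij) ({0..<m} \<times> {0..<n})"])
  show "\<forall>f\<in>({0..<m} \<times> {0..<n}) \<rightarrow>\<^sub>E {1, -1 :: real}.
      restrict (\<lambda>ij. mat m n f $$ ij) ({0..<m} \<times> {0..<n}) = f"
  proof
    fix f :: "nat \<times> nat \<Rightarrow> real"
    assume f: "f \<in> ({0..<m} \<times> {0..<n}) \<rightarrow>\<^sub>E {1, -1}"
    show "restrict (\<lambda>ij. mat m n f $$ ij) ({0..<m} \<times> {0..<n}) = f"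
      using f by (auto simp: PiE_iff extensional_def restrict_def fun_eq_iff)
  qed
  show "\<forall>B\<in>sign_mats m n. mat m n (restrict (\<lambda>ij. B $$ ij) ({0..<m} \<times> {0..<n})) = B"
    by (auto simp: sign_mats_def intro!: eq_matI)
  show "mat m n ` (({0..<m} \<times> {0..<n}) \<rightarrow>\<^sub>E {1, -1}) \<subseteq> sign_mats m n"
    by (auto simp: sign_mats_def PiE_iff)
  show "(\<lambda>B. restrict (\<lambda>ij. B $$ ij) ({0..<m} \<times> {0..<n})) ` sign_mats m n
      \<subseteq> ({0..<m} \<times> {0..<n}) \<rightarrow>\<^sub>E {1, -1}"
  proof (rule image_subsetI)
    fix B assume "B \<in> sign_mats m n"
    then have "B $$ ij \<in> {1, -1}" if "ij \<in> {0..<m} \<times> {0..<n}" for ij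
      using that unfolding sign_mats_def by (cases ij) simp
    then show "restrict (\<lambda>ij. B $$ ij) ({0..<m} \<times> {0..<n})
        \<in> ({0..<m} \<times> {0..<n}) \<rightarrow>\<^sub>E {1, -1}"
      by (rule restrict_PiE_iff[THEN iffD2, rule_format])
  qed
qed

lemma finite_sign_mats: "finite (sign_mats m n)"
  using bij_betw_finite[OF bij_betw_sign_mats, of m n] by (simp add: finite_PiE)

lemma card_sign_mats: "card (sign_mats m n) = 2 ^ (m * n)"
proof -
  have "card {1, -1 :: real} = 2"
    by simp
  then show ?thesis
    using bij_betw_same_card[OF bij_betw_sign_mats, of m n]
    by (simp add: card_PiE numeral_2_eq_2)
qed

lemma sign_mats_nonempty: "sign_mats m n \<noteq> {}"
  using card_sign_mats[of m n] by force

end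

theory Submission
  imports Defs
begin

text \<open>
  Expand the determinant over permutations \<open>p\<close> and the entries of \<open>B B\<^sup>T\<close> over column choices \<open>f\<close>.
  Since the entries of \<open>B\<close> are independent and centred with square \<open>1\<close>, the monomial indexed by
  \<open>p\<close> and \<open>f\<close> has expectation \<open>1\<close> if \<open>f \<circ> p = f\<close> and \<open>0\<close> otherwise. For fixed \<open>f\<close> the signed sum
  of these values is the determinant of the matrix with entries \<open>[f i = f j]\<close>: this is the identity
  matrix if \<open>f\<close> is injective and has two equal rows otherwise. Hence the expectation counts the
  injections from an \<open>m\<close>-set to an \<open>n\<close>-set.
\<close>

text \<open>The entries vary independently over two values, so the sum factors into one sum per
  entry. It vanishes as soon as some entry occurs exactly once in the monomial.\<close>

lemma sum_sign_mats_row_monomial: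
  assumes f: "\<And>i. i < m \<Longrightarrow> f i < n" and g: "\<And>i. i < m \<Longrightarrow> g i < n"
  shows "(\<Sum>B\<in>sign_mats m n. \<Prod>i = 0..<m. B $$ (i, f i) * B $$ (i, g i)) =
    2 ^ (m * n) * (if \<forall>i<m. f i = g i then 1 else 0)"
proof -
  let ?I = "{0..<m} \<times> {0..<n}"
  \<comment> \<open>\<open>h x a\<close> is the factor contributed by the entry at \<open>x\<close>
    when its value is \<open>a\<close>. It is 1 at positions absent from the monomial, so the
    product can run over all of \<open>?I\<close> and sum and product can be exchanged.\<close>
  define h :: "nat \<times> nat \<Rightarrow> real \<Rightarrow> real" where
    "h = (\<lambda>(i, j) a. (if j = f i then a else 1) * (if j = g i then a else 1))"
  have "(\<Sum>B\<in>sign_mats m n. \<Prod>i = 0..<m. B $$ (i, f i) * B $$ (i, g i)) =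
    (\<Sum>b\<in>?I \<rightarrow>\<^sub>E {1, -1}. \<Prod>i = 0..<m. mat m n b $$ (i, f i) * mat m n b $$ (i, g i))"
    by (rule sum.reindex_bij_betw[OF bij_betw_sign_mats, symmetric])
  also have "\<dots> = (\<Sum>b\<in>?I \<rightarrow>\<^sub>E {1, -1}. \<Prod>x\<in>?I. h x (b x))"
  proof (rule sum.cong[OF refl])
    fix b :: "nat \<times> nat \<Rightarrow> real"
    have "(\<Prod>x\<in>?I. h x (b x)) = (\<Prod>i = 0..<m. \<Prod>j = 0..<n. h (i, j) (b (i, j)))"
      by (simp add: prod.cartesian_product split_def)
    also have "\<dots> = (\<Prod>i = 0..<m. mat m n b $$ (i, f i) * mat m n b $$ (i, g i))"
      using f g by (intro prod.cong) (auto simp: h_def prod.distrib prod.delta)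
    finally show "(\<Prod>i = 0..<m. mat m n b $$ (i, f i) * mat m n b $$ (i, g i)) =
        (\<Prod>x\<in>?I. h x (b x))" ..
  qed
  also have "\<dots> = (\<Prod>x\<in>?I. \<Sum>a\<in>{1, -1}. h x a)"
    by (rule prod_sum_PiE[symmetric]) auto
  \<comment> \<open>An entry occurring twice or never contributes 1 + 1, since squares are 1; one
    occurring once contributes 1 - 1.\<close>
  also have "\<dots> = (\<Prod>(i, j)\<in>?I. if (j = f i) = (j = g i) then 2 else 0)"
    by (intro prod.cong) (auto simp: h_def)
  also have "\<dots> = 2 ^ (m * n) * (if \<forall>i<m. f i = g i then 1 else 0)"
  proof (cases "\<forall>i<m. f i = g i")
    case True
    then have "(\<Prod>(i, j)\<in>?I. if (j = f i) = (j = g i) then 2 else (0 :: real)) = (\<Prod>x\<in>?I. 2)"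
      by (intro prod.cong) auto
    with True show ?thesis by simp
  next
    case False
    then obtain i where i: "i < m" "f i \<noteq> g i" by blast
    with f have "(i, f i) \<in> ?I" by auto
    with i have "\<exists>x\<in>?I. (case x of (i, j) \<Rightarrow> if (j = f i) = (j = g i) then 2 else (0 :: real)) = 0"
      by (intro bexI[of _ "(i, f i)"]) auto
    then show ?thesis
      using False by (simp add: prod_zero)
  qed
  finally show ?thesis .
qed

text \<open>Reindexing the second factors by the inverse of \<open>p\<close> moves them to row
  \<open>i\<close>, which reduces to the previous lemma. The indicator is written as a product so
  that it can later serve as a term of a Leibniz expansion.\<close>

lemma sum_sign_mats_permuted_monomial:
  assumes f: "\<And>i. i < m \<Longrightarrow> f i < n" and p: "p permutes {0..<m}"
  shows "(\<Sum>B\<in>sign_mats m n. \<Prod>i = 0..<m. B $$ (i, f i) * B $$ (p i, f i)) =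
    2 ^ (m * n) * (\<Prod>i = 0..<m. if f i = f (p i) then 1 else 0)"
proof -
  let ?q = "Hilbert_Choice.inv p"
  have q: "?q permutes {0..<m}" by (rule permutes_inv[OF p])
  have lt: "p i < m" "?q i < m" if "i < m" for i
    using permutes_in_image[OF p, of i] permutes_in_image[OF q, of i] that by auto
  have "(\<Prod>i = 0..<m. B $$ (p i, f i)) = (\<Prod>i = 0..<m. B $$ (i, f (?q i)))" for B :: "real mat"
    by (subst prod.permute[OF q]) (simp add: o_def permutes_inverses[OF p])
  then have "(\<Sum>B\<in>sign_mats m n. \<Prod>i = 0..<m. B $$ (i, f i) * B $$ (p i, f i)) =
      (\<Sum>B\<in>sign_mats m n. \<Prod>i = 0..<m. B $$ (i, f i) * B $$ (i, f (?q i)))"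
    by (simp add: prod.distrib)
  also have "\<dots> = 2 ^ (m * n) * (if \<forall>i<m. f i = f (?q i) then 1 else 0)"
    using f lt by (intro sum_sign_mats_row_monomial) auto
  also have "(\<forall>i<m. f i = f (?q i)) \<longleftrightarrow> (\<forall>i<m. f i = f (p i))"
    using lt permutes_inverses[OF p] by metis
  also have "(if \<forall>i<m. f i = f (p i) then 1 else 0 :: real) =
      (\<Prod>i = 0..<m. if f i = f (p i) then 1 else 0)"
    by (auto intro!: prod_zero[symmetric] prod.neutral[symmetric])
  finally show ?thesis .
qed

text \<open>Leibniz formula, followed by distributing the product of row sums over choice functions
  \<open>f\<close>.\<close>

lemma det_gram_expand:
  fixes B :: "'a::comm_ring_1 mat"
  assumes B: "B \<in> carrier_mat m n"
  shows "Determinant.det (B * B\<^sup>T) = (\<Sum>p | p permutes {0..<m}. \<Sum>f\<in>{0..<m} \<rightarrow>\<^sub>E {0..<n}.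
    signof p * (\<Prod>i = 0..<m. B $$ (i, f i) * B $$ (p i, f i)))"
proof -
  have entry: "(B * B\<^sup>T) $$ (i, p i) = (\<Sum>k = 0..<n. B $$ (i, k) * B $$ (p i, k))"
    if p: "p permutes {0..<m}" and i: "i < m" for p i
  proof -
    have "p i < m" using permutes_in_image[OF p, of i] i by simp
    with i B show ?thesis by (simp add: scalar_prod_def)
  qed
  have "B * B\<^sup>T \<in> carrier_mat m m" using B by simp
  then have "Determinant.det (B * B\<^sup>T) = (\<Sum>p | p permutes {0..<m}.
      signof p * (\<Prod>i = 0..<m. (B * B\<^sup>T) $$ (i, p i)))"
    by (rule det_def')
  also have "\<dots> = (\<Sum>p | p permutes {0..<m}.
      signof p * (\<Prod>i = 0..<m. \<Sum>k = 0..<n. B $$ (i, k) * B $$ (p i, k)))"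
    by (intro sum.cong refl arg_cong2[where f = "(*)"] prod.cong) (auto simp: entry simp del: index_mult_mat)
  finally show ?thesis
    by (simp add: prod_sum_PiE sum_distrib_left)
qed

lemma det_kernel_mat:
  "Determinant.det (mat m m (\<lambda>(i, j). if f i = f j then 1 else 0) :: 'a::comm_ring_1 mat) =
    (if inj_on f {0..<m} then 1 else 0)"
proof (cases "inj_on f {0..<m}")
  case True
  then have "mat m m (\<lambda>(i, j). if f i = f j then 1 else 0) = (1\<^sub>m m :: 'a mat)"
    by (intro eq_matI) (auto simp: inj_on_def)
  with True show ?thesis by simp
next
  case False
  then obtain i j where ij: "i < m" "j < m" "i \<noteq> j" "f i = f j"
    by (auto simp: inj_on_def)
  have "Determinant.det (mat m m (\<lambda>(i, j). if f i = f j then 1 else 0) :: 'a mat) = 0"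
    using ij by (intro det_identical_rows[of _ m i j]) auto
  with False show ?thesis by simp
qed

lemma card_injections:
  "card {f \<in> {0..<m} \<rightarrow>\<^sub>E {0..<n}. inj_on f {0..<m}} = fact m * (n choose m)"
proof -
  have "card {f \<in> {0..<m} \<rightarrow>\<^sub>E {0..<n}. inj_on f {0..<m}} = (\<Prod>i = 0..<m. n - i)"
    by (subst card_inj_on_subset_funcset) auto
  also have "\<dots> = fact m * (n choose m)"
  proof (cases "m \<le> n")
    case True
    \<comment> \<open>Here \<open>i < m \<le> n\<close>, so truncated subtraction agrees with real
      subtraction and the product is the falling factorial of the generalized binomial.\<close>
    then have "real (\<Prod>i = 0..<m. n - i) = (\<Prod>i = 0..<m. real n - real i)"
      unfolding of_nat_prod by (intro prod.cong) auto
    also have "\<dots> = real (fact m * (n choose m))"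
      by (simp add: gbinomial_mult_fact binomial_gbinomial)
    finally show ?thesis by (simp only: of_nat_eq_iff)
  next
    case False
    \<comment> \<open>For \<open>n < m\<close> the factor at \<open>i = n\<close> is zero, matching
      the zero binomial coefficient.\<close>
    then have "\<exists>i\<in>{0..<m}. n - i = 0"
      by (intro bexI[of _ n]) auto
    then have "(\<Prod>i = 0..<m. n - i) = 0"
      by (intro prod_zero) simp_all
    also have "\<dots> = fact m * (n choose m)"
      using False by (simp add: binomial_eq_0)
    finally show ?thesis .
  qed
  finally show ?thesis .
qed

theorem theorem2:
  fixes m n :: nat
  assumes "m > 0" and "n > 0"
  shows "measure_pmf.expectation (pmf_of_set (sign_mats m n))
           (\<lambda>B. Determinant.det (B * B\<^sup>T)) = fact m * real (n choose m)"
proof -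
  let ?F = "{0..<m} \<rightarrow>\<^sub>E {0..<n}" and ?P = "{p. p permutes {0..<m}}"
  have "(\<Sum>B\<in>sign_mats m n. Determinant.det (B * B\<^sup>T)) =
      (\<Sum>B\<in>sign_mats m n. \<Sum>p\<in>?P. \<Sum>f\<in>?F.
        signof p * (\<Prod>i = 0..<m. B $$ (i, f i) * B $$ (p i, f i)))"
    by (intro sum.cong refl det_gram_expand) (auto simp: sign_mats_def)
  also have "\<dots> = (\<Sum>p\<in>?P. \<Sum>f\<in>?F. \<Sum>B\<in>sign_mats m n.
        signof p * (\<Prod>i = 0..<m. B $$ (i, f i) * B $$ (p i, f i)))"
    by (subst sum.swap, rule sum.cong[OF refl], rule sum.swap)
  also have "\<dots> = (\<Sum>p\<in>?P. \<Sum>f\<in>?F. signof p *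
        (2 ^ (m * n) * (\<Prod>i = 0..<m. if f i = f (p i) then 1 else 0)))"
    by (intro sum.cong refl, subst sum_distrib_left[symmetric],
        subst sum_sign_mats_permuted_monomial) (auto simp: PiE_iff)
  \<comment> \<open>With \<open>f\<close> outermost, the inner sum over \<open>p\<close> becomes the
    Leibniz expansion of one determinant.\<close>
  also have "\<dots> = 2 ^ (m * n) * (\<Sum>f\<in>?F. \<Sum>p\<in>?P. signof p *
        (\<Prod>i = 0..<m. if f i = f (p i) then 1 else 0))"
    by (subst sum.swap) (simp add: sum_distrib_left mult.left_commute)
  also have "(\<Sum>f\<in>?F. \<Sum>p\<in>?P. signof p * (\<Prod>i = 0..<m. if f i = f (p i) then 1 else 0)) =
      (\<Sum>f\<in>?F. Determinant.det (mat m m (\<lambda>(i, j). if f i = f j then 1 else 0) :: real mat))"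
  proof (rule sum.cong[OF refl])
    fix f :: "nat \<Rightarrow> nat"
    have "p i < m" if "p permutes {0..<m}" "i < m" for p i
      using permutes_in_image[OF that(1), of i] that(2) by simp
    then show "(\<Sum>p\<in>?P. signof p * (\<Prod>i = 0..<m. if f i = f (p i) then 1 else 0)) =
        Determinant.det (mat m m (\<lambda>(i, j). if f i = f j then 1 else 0) :: real mat)"
      by (subst det_def'[of _ m]) (auto intro!: sum.cong prod.cong arg_cong2[where f = "(*)"])
  qed
  also have "\<dots> = real (card {f \<in> ?F. inj_on f {0..<m}})"
    by (simp add: det_kernel_mat sum.If_cases finite_PiE Int_def)
  also have "\<dots> = fact m * real (n choose m)"
    by (simp add: card_injections)
  \<comment> \<open>The factor \<open>2 ^ (m * n)\<close> cancels against the number of sign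
    matrices.\<close>
  finally show ?thesis
    by (simp add: integral_pmf_of_set finite_sign_mats sign_mats_nonempty card_sign_mats)
qed

end
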